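(* For every integer $n\ge 3$ and every tree $T$ with $n$ vertices, $$d(C(T),CT(T))\le \left\lfloor \frac{n-3}{4}\right\rfloor .$$
   Context: For vertices $u,v$ of a tree $T$, $d(u,v)$ is the number of edges on the unique path joining them. The eccentricity of $v$ is $ecc_T(v)=\max_{u\in V(T)}d(v,u)$, and the center $C(T)$ is the set of vertices of minimum eccentricity. The distance of $v$ is $d_T(v)=\sum_{u\in V(T)}d(v,u)$, and the centroid $CT(T)$ is the set of vertices minimizing $d_T$. For vertex sets $S,S'$, $d(S,S')=\min\{d(u,v):u\in S,\ v\in S'\}$. *)

theory Defs
  imports Complex_Main "Graph_Theory.Graph_Theory"
begin

text \<open>
  A finite simple graph is a \<^locale>\<open>pair_graph\<close>: a finite, loopfree, symmetric set of pairs, in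
  which an edge \<open>uv\<close> is represented by the two arcs \<open>(u, v)\<close> and \<open>(v, u)\<close>.

  The library constant \<^const>\<open>tree\<close> is not the graph-theoretic notion for such graphs: its
  \<^const>\<open>forest\<close> counts the closed walk \<open>u, v, u\<close> as a cycle, so that no symmetric digraph with an
  arc is a \<^const>\<open>tree\<close>. The cycles of an undirected simple graph are the directed cycles of length
  at least 3.
\<close>

definition undirected_tree :: "'a pair_pre_digraph \<Rightarrow> bool" where
  "undirected_tree T \<longleftrightarrow>
     pair_graph T \<and> connected (with_proj T) \<and>
     \<not> (\<exists>p. pre_digraph.cycle (with_proj T) p \<and> 3 \<le> length p)"

text \<open>\<open>apath\<close> is a walk without repeated vertices, given by its list of arcs; in a tree it is
  determined by its end vertices.\<close>

definition tdist :: "'a pair_pre_digraph \<Rightarrow> 'a \<Rightarrow> 'a \<Rightarrow> nat" where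
  "tdist T u v = length (THE p. pre_digraph.apath (with_proj T) u p v)"

definition ecc :: "'a pair_pre_digraph \<Rightarrow> 'a \<Rightarrow> nat" where
  "ecc T v = Max {tdist T v u | u. u \<in> pverts T}"

definition graph_center :: "'a pair_pre_digraph \<Rightarrow> 'a set" where
  "graph_center T = {v \<in> pverts T. \<forall>w \<in> pverts T. ecc T v \<le> ecc T w}"

definition vertex_distance :: "'a pair_pre_digraph \<Rightarrow> 'a \<Rightarrow> nat" where
  "vertex_distance T v = (\<Sum>u \<in> pverts T. tdist T v u)"

definition graph_centroid :: "'a pair_pre_digraph \<Rightarrow> 'a set" where
  "graph_centroid T =
     {v \<in> pverts T. \<forall>w \<in> pverts T. vertex_distance T v \<le> vertex_distance T w}"

definition set_tdist :: "'a pair_pre_digraph \<Rightarrow> 'a set \<Rightarrow> 'a set \<Rightarrow> nat" where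
  "set_tdist T S S' = Min {tdist T u v | u v. u \<in> S \<and> v \<in> S'}"

end

theory Submission
  imports Defs
begin

text \<open>
  Choose a center vertex \<open>c\<close> and a centroid vertex \<open>w\<close> at the least possible distance \<open>k\<close>, and
  suppose \<open>k > 0\<close>. Let \<open>x\<close> be the neighbour of \<open>c\<close>, and \<open>y\<close> the neighbour of \<open>w\<close>, on the path
  from \<open>c\<close> to \<open>w\<close>. By the choice of the pair, \<open>x\<close> is not a center vertex and \<open>y\<close> is not a centroid
  vertex. Deleting the edge \<open>yw\<close> splits the tree into the side of \<open>y\<close> and the side of \<open>w\<close>.

  The distance sums of \<open>y\<close> and \<open>w\<close> differ by the difference of the sizes of the two sides
  (\<open>sum_dist_adjacent\<close>), so the side of \<open>w\<close> is strictly larger than the side of \<open>y\<close>.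

  Since \<open>x\<close> has larger eccentricity than \<open>c\<close>, a vertex \<open>u\<close> farthest from \<open>x\<close> lies beyond \<open>c\<close>, at
  distance \<open>r\<close> from \<open>c\<close>, where \<open>r\<close> is the eccentricity of \<open>c\<close>. The path from \<open>u\<close> through \<open>c\<close> to
  \<open>y\<close> has \<open>r + k\<close> vertices, all on the side of \<open>y\<close> (\<open>card_side_gt_dist\<close>). The side of \<open>w\<close>, being more
  than half of at least three vertices, contains some \<open>v \<noteq> w\<close>, and \<open>v\<close> is at distance at least
  \<open>k + 1\<close> from \<open>c\<close>; hence \<open>r \<ge> k + 1\<close>. So one side has at least \<open>2 * k + 1\<close> vertices, the other
  one at least \<open>2 * k + 2\<close>, and \<open>n \<ge> 4 * k + 3\<close>.

  This argument needs only distances. The locale \<open>tree_metric\<close> lists what it uses about them, and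
  the graph theory is confined to showing that the distance of a tree has these properties, which
  follow from the existence (\<open>ex_apath\<close>) and uniqueness (\<open>apath_unique\<close>) of paths.
\<close>

section \<open>Tree metrics\<close>

text \<open>
  Vertices at distance 1 play the role of adjacent vertices. The condition \<open>adjacent_dist\<close> expresses
  that a tree is bipartite, and \<open>unique_parent\<close> that a vertex has only one neighbour closer to a
  given root \<open>u\<close>.
\<close>

locale tree_metric =
  fixes V :: "'a set" and d :: "'a \<Rightarrow> 'a \<Rightarrow> nat"
  assumes finite_V: "finite V"
    and dist_eq_0_iff: "u \<in> V \<Longrightarrow> v \<in> V \<Longrightarrow> d u v = 0 \<longleftrightarrow> u = v"
    and dist_commute: "u \<in> V \<Longrightarrow> v \<in> V \<Longrightarrow> d u v = d v u"
    and last_step: "u \<in> V \<Longrightarrow> v \<in> V \<Longrightarrow> d u v = Suc m \<Longrightarrow> \<exists>x\<in>V. d u x = m \<and> d x v = 1"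
    and adjacent_dist: "u \<in> V \<Longrightarrow> x \<in> V \<Longrightarrow> y \<in> V \<Longrightarrow> d x y = 1
      \<Longrightarrow> d u y = Suc (d u x) \<or> d u x = Suc (d u y)"
    and unique_parent: "u \<in> V \<Longrightarrow> x \<in> V \<Longrightarrow> y \<in> V \<Longrightarrow> z \<in> V \<Longrightarrow> d x y = 1 \<Longrightarrow> d z y = 1
      \<Longrightarrow> d u y = Suc (d u x) \<Longrightarrow> d u y = Suc (d u z) \<Longrightarrow> x = z"
begin

lemma dist_triangle:
  assumes "u \<in> V" "x \<in> V" "y \<in> V"
  shows "d u y \<le> d u x + d x y"
  using assms
proof (induction "d x y" arbitrary: y)
  case 0
  then show ?case using dist_eq_0_iff by force
next
  case (Suc m)
  then obtain z where z: "z \<in> V" "d x z = m" "d z y = 1"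
    by (metis last_step)
  then have "d u z \<le> d u x + m" using Suc by blast
  then show ?case using adjacent_dist[of u z y] z Suc by linarith
qed

lemma geodesic_point:
  assumes "u \<in> V" "v \<in> V" "i \<le> d u v"
  shows "\<exists>z\<in>V. d u z = i \<and> d z v = d u v - i"
  using assms
proof (induction "d u v" arbitrary: v)
  case 0
  then show ?case using dist_eq_0_iff[of u u] by (intro bexI[of _ u]) simp_all
next
  case (Suc m)
  show ?case
  proof (cases "i = d u v")
    case True
    then show ?thesis using Suc.prems by (intro bexI[of _ v]) (auto simp: dist_eq_0_iff)
  next
    case False
    obtain x where x: "x \<in> V" "d u x = m" "d x v = 1"
      using last_step[of u v m] Suc.hyps(2) Suc.prems by auto
    moreover have "i \<le> m" using False Suc.hyps(2) Suc.prems by simp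
    ultimately obtain z where z: "z \<in> V" "d u z = i" "d z x = m - i"
      using Suc.hyps(1)[of x] Suc.prems by auto
    have "d z v \<le> Suc (m - i)" using dist_triangle[of z x v] x z Suc.prems by simp
    moreover have "d u v \<le> i + d z v" using dist_triangle[of u z v] z Suc.prems by simp
    ultimately have "d z v = d u v - i" using Suc.hyps(2) \<open>i \<le> m\<close> by linarith
    then show ?thesis using z by blast
  qed
qed

text \<open>
  The path from \<open>u\<close> to \<open>e\<close> that leaves \<open>a\<close> towards \<open>b\<close> never turns back: after a step away from
  \<open>u\<close>, the parent of the current vertex is the one just left, so every other neighbour is farther
  from \<open>u\<close>. It is needed for both ends of the path from center to centroid.
\<close>

lemma dist_away:
  assumes "u \<in> V" "a \<in> V" "b \<in> V" "e \<in> V"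
    and "d a b = 1" "d a e = Suc (d b e)" "d u b = Suc (d u a)"
  shows "d u e = d u a + d a e"
  using assms
proof (induction "d b e" arbitrary: a b)
  case 0
  then show ?case using dist_eq_0_iff by force
next
  case (Suc j)
  then obtain b' where b': "b' \<in> V" "d e b' = j" "d b' b = 1"
    using last_step[of e b j] dist_commute by metis
  have "d e a = Suc (Suc j)" using Suc dist_commute by simp
  then have "b' \<noteq> a" using b' by auto
  then have "d u b' = Suc (d u b)"
    using adjacent_dist[of u b' b] unique_parent[of u a b b'] b' Suc.prems by auto
  then have "d u e = d u b + d b e"
    using Suc.hyps(1)[of b' b] Suc.hyps(2) Suc.prems b' dist_commute by metis
  then show ?case using Suc.prems by simp
qed

text \<open>
  For adjacent \<open>x\<close> and \<open>y\<close> this is the component of \<open>x\<close> after the edge \<open>xy\<close> is deleted.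
\<close>

definition side :: "'a \<Rightarrow> 'a \<Rightarrow> 'a set" where
  "side x y = {z \<in> V. d x z < d y z}"

lemma side_subset: "side x y \<subseteq> V"
  by (auto simp: side_def)

lemma finite_side: "finite (side x y)"
  using finite_V side_subset finite_subset by blast

lemma sides_disjoint: "side x y \<inter> side y x = {}"
  by (auto simp: side_def)

lemma in_side_iff:
  assumes "x \<in> V" "y \<in> V" "d x y = 1" "z \<in> V"
  shows "z \<in> side x y \<longleftrightarrow> d y z = Suc (d x z)"
  using adjacent_dist[of z x y] assms dist_commute[of z] by (auto simp: side_def)

lemma sides_cover:
  assumes "x \<in> V" "y \<in> V" "d x y = 1"
  shows "side x y \<union> side y x = V"
proof
  show "side x y \<union> side y x \<subseteq> V" using side_subset by blast
  show "V \<subseteq> side x y \<union> side y x"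
  proof
    fix z assume "z \<in> V"
    then show "z \<in> side x y \<union> side y x"
      using adjacent_dist[of z x y] assms by (auto simp: side_def dist_commute)
  qed
qed

lemma card_sides:
  assumes "x \<in> V" "y \<in> V" "d x y = 1"
  shows "card (side x y) + card (side y x) = card V"
  using card_Un_disjoint[OF finite_side finite_side sides_disjoint] sides_cover[OF assms] by metis

text \<open>
  Moving from \<open>x\<close> to an adjacent \<open>y\<close> brings each vertex on the side of \<open>y\<close> closer by one and moves
  each vertex on the side of \<open>x\<close> away by one. The equation is arranged so as to avoid subtraction.
\<close>

lemma sum_dist_adjacent:
  assumes "x \<in> V" "y \<in> V" "d x y = 1"
  shows "(\<Sum>z\<in>V. d x z) + card (side x y) = (\<Sum>z\<in>V. d y z) + card (side y x)"
proof -
  have split: "(\<Sum>z\<in>V. f z) = (\<Sum>z\<in>side x y. f z) + (\<Sum>z\<in>side y x. f z)" for f :: "'a \<Rightarrow> nat"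
    using sum.union_disjoint[OF finite_side finite_side sides_disjoint, of f x y]
      sides_cover[OF assms] by simp
  have "(\<Sum>z\<in>side x y. d y z) = (\<Sum>z\<in>side x y. d x z + 1)"
    using in_side_iff[OF assms] side_subset[of x y] by (intro sum.cong) auto
  moreover have "(\<Sum>z\<in>side y x. d x z) = (\<Sum>z\<in>side y x. d y z + 1)"
    using in_side_iff[of y x] assms side_subset[of y x]
    by (intro sum.cong) (auto simp: dist_commute)
  ultimately show ?thesis
    unfolding split by (simp add: sum_Suc)
qed

text \<open>
  The \<open>d x u + 1\<close> vertices on the path from \<open>x\<close> to \<open>u\<close> all lie on the side of \<open>x\<close>: a vertex of the
  path that is no farther from \<open>y\<close> than from \<open>x\<close> would give \<open>y\<close> a path to \<open>u\<close> that is too short.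
\<close>

lemma card_side_gt_dist:
  assumes "x \<in> V" "y \<in> V" "d x y = 1" "u \<in> side x y"
  shows "d x u < card (side x y)"
proof -
  have u: "u \<in> V" "d y u = Suc (d x u)"
    using assms in_side_iff side_subset by blast+
  have "\<exists>f. \<forall>i\<le>d x u. f i \<in> V \<and> d x (f i) = i \<and> d (f i) u = d x u - i"
    using geodesic_point[of x u] assms(1) u(1) by metis
  then obtain f where f: "\<And>i. i \<le> d x u \<Longrightarrow> f i \<in> V \<and> d x (f i) = i \<and> d (f i) u = d x u - i"
    by blast
  have "f i \<in> side x y" if "i \<le> d x u" for i
    using dist_triangle[of y "f i" u] f[OF that] u assms that by (simp add: side_def)
  then have "f ` {..d x u} \<subseteq> side x y" by auto
  moreover have "inj_on f {..d x u}" using f by (metis atMost_iff inj_onI)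
  ultimately have "card {..d x u} \<le> card (side x y)"
    by (metis card_inj_on_le finite_side)
  then show ?thesis by simp
qed

text \<open>
  The counting argument, with only what is used about center and centroid: \<open>y\<close>, the last vertex
  before \<open>w\<close>, has a larger distance sum than \<open>w\<close>, and \<open>u\<close> witnesses that \<open>x\<close>, the first vertex
  after \<open>c\<close>, has larger eccentricity than \<open>c\<close>.
\<close>

lemma card_ge_four_times_dist:
  assumes V: "c \<in> V" "w \<in> V" "x \<in> V" "y \<in> V" and "3 \<le> card V"
    and x: "d c x = 1" "d c w = Suc (d x w)"
    and y: "d y w = 1" "d c w = Suc (d c y)"
    and centroid: "(\<Sum>z\<in>V. d w z) < (\<Sum>z\<in>V. d y z)"
    and center: "u \<in> V" "\<And>v. v \<in> V \<Longrightarrow> d c v < d x u"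
  shows "4 * d c w + 3 \<le> card V"
proof -
  have bigger: "card (side y w) < card (side w y)"
    using sum_dist_adjacent[of y w] V y centroid by simp
  have total: "card (side y w) + card (side w y) = card V"
    using card_sides V y by simp
  \<comment> \<open>The other alternative is excluded as \<open>d c u < d x u\<close>: \<open>u\<close> lies beyond \<open>c\<close>, seen from \<open>x\<close>.\<close>
  have ux: "d u x = Suc (d u c)"
    using adjacent_dist[of u c x] center center(2)[of u] dist_commute V x by fastforce
  have uw: "d u w = d u c + d c w"
    using dist_away[of u c x w] V x center ux by simp
  have "d u y \<le> d u c + d c y" using dist_triangle V center by simp
  then have uy: "d u w = Suc (d u y)"
    using adjacent_dist[of u y w] uw V y center by simp
  have "u \<in> side y w"
    using in_side_iff[of y w u] V y center uy dist_commute by simp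
  then have large: "d u c + d c w \<le> card (side y w)"
    using card_side_gt_dist[of y w u] V y center uy uw dist_commute[of u y] by simp
  have "\<exists>v\<in>side w y. v \<noteq> w"
  proof (rule ccontr)
    assume "\<not> ?thesis"
    then have "side w y \<subseteq> {w}" by blast
    then have "card (side w y) \<le> card {w}" by (intro card_mono) simp_all
    then show False using bigger total \<open>3 \<le> card V\<close> by simp
  qed
  then obtain v where v: "v \<in> side w y" "v \<noteq> w" by blast
  then have "v \<in> V" using side_subset by blast
  have "d v y = Suc (d v w)"
    using in_side_iff[of w y v] v V y \<open>v \<in> V\<close> dist_commute by metis
  then have "d v c = d v w + d w c"
    using dist_away[of v w y c] V y \<open>v \<in> V\<close> dist_commute by metis
  moreover have "d v w \<noteq> 0" using v V \<open>v \<in> V\<close> dist_eq_0_iff by blast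
  ultimately have "d c w < d c v" using dist_commute V \<open>v \<in> V\<close> by simp
  also have "d c v \<le> d u c"
    using center ux V \<open>v \<in> V\<close> dist_commute less_Suc_eq_le by metis
  finally show ?thesis using large bigger total by simp
qed

end

section \<open>Paths in a tree\<close>

locale tree_graph = pair_graph T for T :: "'a pair_pre_digraph" +
  assumes undirected_tree: "undirected_tree T"
begin

lemma ex_apath:
  assumes "u \<in> pverts T" "v \<in> pverts T"
  shows "\<exists>p. apath u p v"
proof -
  have "connected (with_proj T)" using undirected_tree by (simp add: undirected_tree_def)
  then have "u \<rightarrow>\<^sup>*\<^bsub>with_proj (mk_symmetric (with_proj T))\<^esub> v"
    using assms by (auto simp: connected_def strongly_connected_def)
  then have "u \<rightarrow>\<^sup>*\<^bsub>with_proj T\<^esub> v"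
    using reachable_mk_symmetric_eq pair_sym_arcs by blast
  then show ?thesis using reachable_apath by simp
qed

lemma ex_apath_within:
  assumes "awalk u p v"
  shows "\<exists>q. apath u q v \<and> set (pawalk_verts u q) \<subseteq> set (pawalk_verts u p)"
proof -
  have a: "apath u (awalk_to_apath p) v" using assms apath_awalk_to_apath by blast
  have "set (awalk_to_apath p) \<subseteq> set p" using assms awalk_to_apath_subset by blast
  then have "set (pawalk_verts u (awalk_to_apath p)) \<subseteq> set (pawalk_verts u p)"
    unfolding set_awalk_verts[OF awalkI_apath[OF a]] set_awalk_verts[OF assms] set_map
    by (intro Un_mono image_mono subset_refl)
  with a show ?thesis by (intro exI[of _ "awalk_to_apath p"] conjI)
qed

text \<open>
  A walk between two distinct neighbours of \<open>u\<close> that avoids \<open>u\<close> could be shortened to a path, and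
  closing this path through \<open>u\<close> would give a cycle. As the path has at least one arc, the cycle has
  length at least 3 and does not merely go along an edge and back.
\<close>

lemma no_detour:
  assumes "(u, a) \<in> parcs T" "(u, b) \<in> parcs T" "a \<noteq> b" "awalk a p b"
  shows "u \<in> set (pawalk_verts a p)"
proof (rule ccontr)
  assume "u \<notin> set (pawalk_verts a p)"
  then obtain q where q: "apath a q b" "u \<notin> set (pawalk_verts a q)"
    using ex_apath_within[OF assms(4)] by blast
  let ?c = "(u, a) # q @ [(b, u)]"
  have bu: "(b, u) \<in> parcs T" using assms(2) arcs_symmetric by blast
  have aq: "awalk a q b" using q awalkI_apath by blast
  have "awalk b [(b, u)] u" using bu in_arcsD1 in_arcsD2 by (auto simp: awalk_simps)
  then have "awalk a (q @ [(b, u)]) u" using aq by (metis awalk_appendI)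
  then have "awalk u ?c u" using assms(1) in_arcsD1 unfolding awalk_Cons_iff by simp
  moreover have "pawalk_verts a (q @ [(b, u)]) = pawalk_verts a q @ [u]"
    using awalk_verts_append[OF \<open>awalk a (q @ [(b, u)]) u\<close>] by simp
  then have "distinct (tl (pawalk_verts u ?c))"
    using q by (simp add: apath_def)
  moreover have "q \<noteq> []" using q \<open>a \<noteq> b\<close> by (auto simp: apath_Nil_iff)
  ultimately have "cycle ?c" "3 \<le> length ?c"
    unfolding cycle_def by (auto simp: Suc_le_eq)
  then show False using undirected_tree unfolding undirected_tree_def by blast
qed

text \<open>
  If two paths from \<open>u\<close> to \<open>v\<close> began with different arcs, following the rest of the first one
  forwards and the rest of the second one backwards would join two neighbours of \<open>u\<close> without
  meeting \<open>u\<close>. So the first arcs agree, and induction applies.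
\<close>

lemma apath_unique:
  assumes "apath u p v" "apath u q v"
  shows "p = q"
  using assms
proof (induction p arbitrary: u q)
  case Nil
  then show ?case using apath_nonempty_ends[of u q v] by (auto simp: apath_Nil_iff)
next
  case (Cons e p)
  then have "q \<noteq> []" using apath_nonempty_ends[of u "e # p" v] by (auto simp: apath_Nil_iff)
  then obtain f q' where q: "q = f # q'" by (cases q) auto
  obtain a b where e: "e = (u, a)" and f: "f = (u, b)"
    using Cons.prems q by (cases e; cases f) (auto simp: apath_Cons_iff)
  have p: "apath a p v" "u \<notin> set (pawalk_verts a p)" "(u, a) \<in> parcs T"
    using Cons.prems(1) e by (auto simp: apath_Cons_iff)
  have q': "apath b q' v" "u \<notin> set (pawalk_verts b q')" "(u, b) \<in> parcs T"
    using Cons.prems(2) q f by (auto simp: apath_Cons_iff)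
  have w: "awalk a p v" "awalk v (rev_path q') b"
    using p q' awalkI_apath by simp_all
  then have "awalk a (p @ rev_path q') b" by (rule awalk_appendI)
  moreover have "set (pawalk_verts a (p @ rev_path q'))
      = set (pawalk_verts a p) \<union> set (pawalk_verts b q')"
    using set_awalk_verts_append[OF w] awalk_verts_rev_path[OF awalkI_apath[OF q'(1)]] by simp
  ultimately have "a = b" using no_detour p q' by blast
  then show ?case using Cons.IH p q' e f q by blast
qed

lemma tdist_eq_length:
  assumes "apath u p v"
  shows "tdist T u v = length p"
proof -
  have "(THE p. apath u p v) = p"
    by (rule the_equality[of "\<lambda>p. apath u p v"]) (fact assms, rule apath_unique[OF _ assms])
  then show ?thesis by (simp add: tdist_def)
qed

lemma tdist_eq_0_iff:
  assumes "u \<in> pverts T" "v \<in> pverts T"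
  shows "tdist T u v = 0 \<longleftrightarrow> u = v"
proof -
  obtain p where p: "apath u p v" using ex_apath assms by blast
  then show ?thesis
    using tdist_eq_length[OF p] apath_nonempty_ends[of u p v] assms by (auto simp: apath_Nil_iff)
qed

lemma tdist_commute:
  assumes "u \<in> pverts T" "v \<in> pverts T"
  shows "tdist T u v = tdist T v u"
proof -
  obtain p where p: "apath u p v" using ex_apath assms by blast
  have "length (rev_path p) = length p" by (induction p) auto
  moreover have "apath v (rev_path p) u" using p by simp
  ultimately show ?thesis using tdist_eq_length[OF p] tdist_eq_length[of v "rev_path p" u] by simp
qed

lemma arc_apath: "(x, y) \<in> parcs T \<Longrightarrow> apath x [(x, y)] y"
  using no_loops' in_arcsD2 by (auto simp: apath_simps)

lemma tdist_eq_1_iff: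
  assumes "x \<in> pverts T" "y \<in> pverts T"
  shows "tdist T x y = 1 \<longleftrightarrow> (x, y) \<in> parcs T"
proof
  assume *: "tdist T x y = 1"
  obtain p where p: "apath x p y" using ex_apath assms by blast
  then have "length p = 1" using tdist_eq_length * by simp
  then obtain e where "p = [e]" by (auto simp: length_Suc_conv)
  then show "(x, y) \<in> parcs T" using p by (auto simp: apath_simps)
next
  assume "(x, y) \<in> parcs T"
  then show "tdist T x y = 1" using tdist_eq_length[OF arc_apath] by simp
qed

lemma apath_snocD:
  assumes "apath u (p @ [(x, y)]) v"
  shows "apath u p x \<and> y = v \<and> (x, y) \<in> parcs T"
  using assms by (auto simp: apath_append_iff apath_simps)

text \<open>
  If \<open>y\<close> lies on the path from \<open>u\<close> to its neighbour \<open>x\<close>, then the part of the path from \<open>y\<close> to \<open>x\<close>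
  is the single arc, by uniqueness.
\<close>

lemma apath_extend_or_shorten:
  assumes "(x, y) \<in> parcs T" "apath u p x"
  shows "apath u (p @ [(x, y)]) y \<or> (\<exists>q. p = q @ [(y, x)] \<and> apath u q y)"
proof (cases "y \<in> set (pawalk_verts u p)")
  case False
  have w: "awalk u p x" "awalk x [(x, y)] y"
    using assms arc_apath awalkI_apath by blast+
  then have a: "awalk u (p @ [(x, y)]) y" by (rule awalk_appendI)
  have "pawalk_verts u (p @ [(x, y)]) = pawalk_verts u p @ [y]"
    using awalk_verts_append[OF a] by simp
  then show ?thesis using a False assms(2) by (simp add: apath_def)
next
  case True
  then obtain q r where qr: "p = q @ r" "awalk u q y" "awalk y r x"
    using awalk_decomp[OF awalkI_apath[OF assms(2)] True] by blast
  have "last (pawalk_verts u q) = y" using qr(2) by (rule awalkE)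
  then have "apath u q y" "apath y r x"
    using assms(2) unfolding qr(1) apath_append_iff by simp_all
  moreover have "r = [(y, x)]"
    using apath_unique[OF \<open>apath y r x\<close> arc_apath] arcs_symmetric assms(1) by blast
  ultimately show ?thesis using qr by blast
qed

lemma ex_apath_last_arc:
  assumes "u \<in> pverts T" "(x, y) \<in> parcs T" "tdist T u y = Suc (tdist T u x)"
  shows "\<exists>p. apath u (p @ [(x, y)]) y"
proof -
  obtain p where p: "apath u p x" using ex_apath assms(1,2) in_arcsD1 by blast
  have "\<not> (\<exists>q. p = q @ [(y, x)] \<and> apath u q y)"
    using assms(3) tdist_eq_length[OF p] tdist_eq_length[of u _ y] by fastforce
  then show ?thesis using apath_extend_or_shorten[OF assms(2) p] by blast
qed

sublocale tree_metric "pverts T" "tdist T"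
proof
  show "finite (pverts T)" by (rule pair_finite_verts)
next
  fix u v m assume "u \<in> pverts T" "v \<in> pverts T" and m: "tdist T u v = Suc m"
  then obtain p where p: "apath u p v" using ex_apath by blast
  then have "length p = Suc m" using m tdist_eq_length by simp
  then obtain q x y where q: "p = q @ [(x, y)]" "length q = m"
    by (cases p rule: rev_cases) auto
  then have x: "apath u q x" "(x, v) \<in> parcs T" using apath_snocD p by blast+
  then have "x \<in> pverts T" using in_arcsD1 by blast
  moreover have "tdist T u x = m" using tdist_eq_length[OF x(1)] q(2) by simp
  moreover have "tdist T x v = 1" using tdist_eq_length[OF arc_apath[OF x(2)]] by simp
  ultimately show "\<exists>x\<in>pverts T. tdist T u x = m \<and> tdist T x v = 1" by blast
next
  fix u x y assume "u \<in> pverts T" "x \<in> pverts T" "y \<in> pverts T" "tdist T x y = 1"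
  then have xy: "(x, y) \<in> parcs T" using tdist_eq_1_iff by blast
  obtain p where p: "apath u p x" using ex_apath \<open>u \<in> pverts T\<close> \<open>x \<in> pverts T\<close> by blast
  show "tdist T u y = Suc (tdist T u x) \<or> tdist T u x = Suc (tdist T u y)"
    using apath_extend_or_shorten[OF xy p] tdist_eq_length[OF p] tdist_eq_length[of u _ y]
    by fastforce
next
  fix u x y z
  assume V: "u \<in> pverts T" "x \<in> pverts T" "y \<in> pverts T" "z \<in> pverts T"
    and adj: "tdist T x y = 1" "tdist T z y = 1"
    and d: "tdist T u y = Suc (tdist T u x)" "tdist T u y = Suc (tdist T u z)"
  then obtain p q where "apath u (p @ [(x, y)]) y" "apath u (q @ [(z, y)]) y"
    using ex_apath_last_arc[of u x y] ex_apath_last_arc[of u z y] tdist_eq_1_iff by blast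
  then have "p @ [(x, y)] = q @ [(z, y)]" by (rule apath_unique)
  then show "x = z" by simp
qed (use tdist_eq_0_iff tdist_commute in auto)

section \<open>Center and centroid\<close>

lemma tdist_le_ecc:
  assumes "v \<in> pverts T" "u \<in> pverts T"
  shows "tdist T v u \<le> ecc T v"
  unfolding ecc_def using assms finite_V by (intro Max_ge) auto

lemma ecc_attained:
  assumes "v \<in> pverts T"
  shows "\<exists>u\<in>pverts T. tdist T v u = ecc T v"
proof -
  have "ecc T v \<in> {tdist T v u |u. u \<in> pverts T}"
    unfolding ecc_def using assms finite_V by (intro Max_in) auto
  then show ?thesis by auto
qed

lemma graph_center_nonempty:
  assumes "pverts T \<noteq> {}"
  shows "graph_center T \<noteq> {}"
  using ex_is_arg_min_if_finite[OF finite_V assms, of "ecc T"]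
  by (auto simp: graph_center_def is_arg_min_linorder)

lemma graph_centroid_nonempty:
  assumes "pverts T \<noteq> {}"
  shows "graph_centroid T \<noteq> {}"
  using ex_is_arg_min_if_finite[OF finite_V assms, of "vertex_distance T"]
  by (auto simp: graph_centroid_def is_arg_min_linorder)

lemma set_tdist_attained:
  assumes "S \<noteq> {}" "S' \<noteq> {}" "S \<subseteq> pverts T" "S' \<subseteq> pverts T"
  obtains c w where "c \<in> S" "w \<in> S'" "set_tdist T S S' = tdist T c w"
    "\<And>c' w'. c' \<in> S \<Longrightarrow> w' \<in> S' \<Longrightarrow> tdist T c w \<le> tdist T c' w'"
proof -
  let ?D = "{tdist T u v | u v. u \<in> S \<and> v \<in> S'}"
  have "finite S" "finite S'" using assms finite_V finite_subset by blast+
  then have fin: "finite ?D" using finite_image_set2[of "\<lambda>u. u \<in> S" "\<lambda>v. v \<in> S'"] by simp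
  have "Min ?D \<in> ?D" using assms by (intro Min_in[OF fin]) auto
  then obtain c w where cw: "c \<in> S" "w \<in> S'" "tdist T c w = Min ?D" by force
  moreover have "tdist T c w \<le> tdist T c' w'" if "c' \<in> S" "w' \<in> S'" for c' w'
    unfolding cw(3) using that by (intro Min_le[OF fin]) auto
  ultimately show ?thesis using that by (simp add: set_tdist_def)
qed

text \<open>
  A closest pair serves twice: the vertex next to \<open>c\<close> is closer to \<open>w\<close> and hence not in the center,
  and the vertex next to \<open>w\<close> is closer to \<open>c\<close> and hence not in the centroid.
\<close>

lemma center_centroid_dist_bound:
  assumes "3 \<le> card (pverts T)"
  shows "4 * set_tdist T (graph_center T) (graph_centroid T) + 3 \<le> card (pverts T)"
proof -
  have ne: "pverts T \<noteq> {}" using assms by auto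
  have sub: "graph_center T \<subseteq> pverts T" "graph_centroid T \<subseteq> pverts T"
    by (auto simp: graph_center_def graph_centroid_def)
  obtain c w where cw: "c \<in> graph_center T" "w \<in> graph_centroid T"
    and k: "set_tdist T (graph_center T) (graph_centroid T) = tdist T c w"
    and closest: "\<And>c' w'. c' \<in> graph_center T \<Longrightarrow> w' \<in> graph_centroid T
      \<Longrightarrow> tdist T c w \<le> tdist T c' w'"
    using set_tdist_attained[OF graph_center_nonempty[OF ne] graph_centroid_nonempty[OF ne] sub]
    by metis
  have V: "c \<in> pverts T" "w \<in> pverts T" using cw sub by auto
  show ?thesis
  proof (cases "tdist T c w")
    case 0
    then show ?thesis using assms k by simp
  next
    case (Suc j)
    obtain y where y: "y \<in> pverts T" "tdist T c y = j" "tdist T y w = 1"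
      using last_step[OF V Suc] by blast
    obtain x where x: "x \<in> pverts T" "tdist T w x = j" "tdist T x c = 1"
      using last_step[of w c j] V Suc tdist_commute[of w c] by auto
    have "y \<notin> graph_centroid T" using closest[OF cw(1), of y] y Suc by auto
    then obtain z where "z \<in> pverts T" "vertex_distance T z < vertex_distance T y"
      using y by (auto simp: graph_centroid_def not_le)
    moreover from this have "vertex_distance T w \<le> vertex_distance T z"
      using cw(2) by (simp add: graph_centroid_def)
    ultimately have centroid:
      "(\<Sum>z\<in>pverts T. tdist T w z) < (\<Sum>z\<in>pverts T. tdist T y z)"
      unfolding vertex_distance_def by simp
    have "x \<notin> graph_center T" using closest[OF _ cw(2), of x] x V Suc tdist_commute[of x w] by auto
    then obtain z where "z \<in> pverts T" "ecc T z < ecc T x"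
      using x by (auto simp: graph_center_def not_le)
    moreover from this have "ecc T c \<le> ecc T z" using cw(1) by (simp add: graph_center_def)
    moreover obtain u where u: "u \<in> pverts T" "tdist T x u = ecc T x"
      using ecc_attained x by blast
    ultimately have center: "tdist T c v < tdist T x u" if "v \<in> pverts T" for v
      using tdist_le_ecc[OF V(1) that] by simp
    show ?thesis unfolding k
    proof (rule card_ge_four_times_dist[of c w x y u])
      show "tdist T c x = 1" "tdist T c w = Suc (tdist T x w)"
        using x V Suc tdist_commute[of x c] tdist_commute[of x w] by auto
    qed (use V x y assms Suc centroid center u in auto)
  qed
qed

end

theorem theorem2p2:
  fixes T :: "'a pair_pre_digraph" and n :: nat
  assumes "n \<ge> 3"
    and "undirected_tree T"
    and "card (pverts T) = n"
  shows "int (set_tdist T (graph_center T) (graph_centroid T)) \<le> \<lfloor>(real n - 3) / 4\<rfloor>"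
proof -
  interpret pair_graph T using assms(2) by (simp add: undirected_tree_def)
  interpret tree_graph T using assms(2) by unfold_locales
  have "4 * set_tdist T (graph_center T) (graph_centroid T) + 3 \<le> n"
    using center_centroid_dist_bound assms by simp
  then show ?thesis by (simp add: le_floor_iff)
qed

end
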